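(* Let $G$ be a finite simple graph and let $H$ be a spanning subgraph of $G$ (that is, $V(H)=V(G)$ and $E(H)\subseteq E(G)$). Then for any $B\subseteq V(G)$, $$\zeta_G(B)\le \zeta_H(B).$$
   Context: For a finite simple graph $G$ and a subset $B\subseteq V(G)$, the $B$-restricted clique polynomial is $C_B(G;x)=\sum_{i=0}^{\omega(G[B])} c_i(B)x^i$, where $c_i(B)$ is the number of subsets $K\subseteq B$ with $|K|=i$ that are cliques in $G$; the empty set counts as a clique, so $c_0(B)=1$. Let $Z_B(G)=\{x<0 : C_B(G;x)=0\}$ (real $x$). If $Z_B(G)\neq\emptyset$, define $\zeta_G(B)=\max Z_B(G)$, the largest negative root of $C_B(G;x)$; if $Z_B(G)=\emptyset$, set $\zeta_G(B)=-\infty$. *)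

theory Defs
  imports
    "HOL-Library.Ramsey"
    "HOL-Library.Extended_Real"
    "HOL-Computational_Algebra.Polynomial"
begin

text \<open>
  A graph is a vertex set \<open>V\<close> together with a set \<open>E\<close> of two-element subsets of \<open>V\<close>.
  \<open>[V]\<^bsup>k\<^esup>\<close> is the set of \<open>k\<close>-element subsets of \<open>V\<close>, and
  \<open>clique K E\<close> says that any two distinct elements of \<open>K\<close> form an edge in \<open>E\<close>
  (both from \<open>HOL-Library.Ramsey\<close>).
\<close>

definition finite_simple_graph :: "'a set \<Rightarrow> 'a set set \<Rightarrow> bool" where
  "finite_simple_graph V E \<longleftrightarrow> finite V \<and> E \<subseteq> [V]\<^bsup>2\<^esup>"

definition spanning_subgraph :: "'a set \<Rightarrow> 'a set set \<Rightarrow> 'a set \<Rightarrow> 'a set set \<Rightarrow> bool" where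
  "spanning_subgraph W F V E \<longleftrightarrow> finite_simple_graph W F \<and> W = V \<and> F \<subseteq> E"

definition induced_edges :: "'a set set \<Rightarrow> 'a set \<Rightarrow> 'a set set" where
  "induced_edges E B = {e \<in> E. e \<subseteq> B}"

definition clique_number :: "'a set \<Rightarrow> 'a set set \<Rightarrow> nat" where
  "clique_number V E = Max {card K | K. K \<subseteq> V \<and> clique K E}"

definition num_cliques :: "'a set set \<Rightarrow> 'a set \<Rightarrow> nat \<Rightarrow> nat" where
  "num_cliques E B i = card {K \<in> [B]\<^bsup>i\<^esup>. clique K E}"

definition clique_poly :: "'a set set \<Rightarrow> 'a set \<Rightarrow> real poly" where
  "clique_poly E B =
     (\<Sum>i = 0..clique_number B (induced_edges E B). monom (of_nat (num_cliques E B i)) i)"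

definition neg_roots :: "'a set set \<Rightarrow> 'a set \<Rightarrow> real set" where
  "neg_roots E B = {x. x < 0 \<and> poly (clique_poly E B) x = 0}"

definition zeta :: "'a set set \<Rightarrow> 'a set \<Rightarrow> ereal" where
  "zeta E B = (if neg_roots E B = {} then -\<infinity> else ereal (Max (neg_roots E B)))"

lemma poly_clique_poly:
  "poly (clique_poly E B) x =
     (\<Sum>i = 0..clique_number B (induced_edges E B). of_nat (num_cliques E B i) * x ^ i)"
  by (simp add: clique_poly_def poly_sum poly_monom)

lemma num_cliques_0 [simp]: "num_cliques E B 0 = 1"
proof -
  have "{K \<in> [B]\<^bsup>0\<^esup>. clique K E} = {{}}"
    by (auto simp: nsets_def)
  then show ?thesis
    by (simp add: num_cliques_def)
qed

lemma coeff_clique_poly_0 [simp]: "coeff (clique_poly E B) 0 = 1"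
  by (simp add: clique_poly_def coeff_sum sum.delta)

text \<open>Hence the maximum in \<^const>\<open>zeta\<close> is always taken over a finite set.\<close>

lemma finite_neg_roots: "finite (neg_roots E B)"
proof -
  have "clique_poly E B \<noteq> 0"
    by (metis coeff_0 coeff_clique_poly_0 zero_neq_one)
  then show ?thesis
    by (auto simp: neg_roots_def intro: finite_subset[OF _ poly_roots_finite])
qed

end

theory Submission
  imports Defs
begin

text \<open>
  Say that \<open>x \<le> 0\<close> is admissible for \<open>B\<close> if the clique polynomial is positive on \<open>[x, 0]\<close>.
  Splitting cliques by whether they contain a vertex \<open>v\<close> gives
  \<open>C\<^sub>B = C\<^sub>B\<^sub>-\<^sub>v + x C\<^sub>N\<close> with \<open>N\<close> the neighbourhood of \<open>v\<close> in \<open>B\<close>; since \<open>x < 0\<close>, a largest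
  negative root of \<open>C\<^sub>B\<^sub>-\<^sub>v\<close> in \<open>[x, 0]\<close> is impossible by induction, so admissibility passes to
  subsets of \<open>B\<close>. Adding an edge \<open>uv\<close> adds \<open>x\<^sup>2 C\<^sub>M\<close>, where \<open>M\<close> is the common neighbourhood
  of \<open>u\<close> and \<open>v\<close> in \<open>B\<close>, and this term is nonnegative where \<open>B\<close> is admissible.
\<close>

section \<open>Clique polynomials as sums over cliques\<close>

definition cliques :: "'a set set \<Rightarrow> 'a set \<Rightarrow> 'a set set" where
  "cliques E B = {K. K \<subseteq> B \<and> clique K E}"

text \<open>With one summand per clique, the recursions below come from bijections between sets of
  cliques, and no clique number appears as a summation bound.\<close>

definition clique_sum :: "'a set set \<Rightarrow> 'a set \<Rightarrow> real \<Rightarrow> real" where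
  "clique_sum E B x = (\<Sum>K\<in>cliques E B. x ^ card K)"

lemma finite_cliques: "finite B \<Longrightarrow> finite (cliques E B)"
  by (simp add: cliques_def)

lemma clique_sum_0:
  fixes B :: "'a set"
  assumes "finite B"
  shows "clique_sum E B 0 = 1"
proof -
  have "clique_sum E B 0 = (\<Sum>K\<in>{{} :: 'a set}. (0::real) ^ card K)"
    unfolding clique_sum_def
    by (rule sum.mono_neutral_right)
       (use assms in \<open>auto simp: finite_cliques cliques_def clique_def card_gt_0_iff
          intro!: zero_power dest: finite_subset\<close>)
  then show ?thesis by simp
qed

lemma continuous_on_clique_sum: "continuous_on A (clique_sum E B)"
  unfolding clique_sum_def by (intro continuous_intros)

text \<open>Group the cliques by size. Within \<open>B\<close>, \<open>E\<close> and its induced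
  edges have the same cliques, so the clique number bounds every size and the truncated sum loses
  nothing.\<close>

lemma poly_clique_poly_eq_clique_sum:
  assumes "finite B"
  shows "poly (clique_poly E B) x = clique_sum E B x"
proof -
  have ind: "K \<subseteq> B \<Longrightarrow> clique K (induced_edges E B) \<longleftrightarrow> clique K E" for K
    by (auto simp: clique_def induced_edges_def)
  have bound: "card K \<le> clique_number B (induced_edges E B)" if "K \<in> cliques E B" for K
    unfolding clique_number_def
  proof (rule Max_ge)
    have "{card K |K. K \<subseteq> B \<and> clique K (induced_edges E B)} \<subseteq> card ` Pow B" by auto
    then show "finite {card K |K. K \<subseteq> B \<and> clique K (induced_edges E B)}"
      using assms by (meson finite_Pow_iff finite_imageI finite_subset)
    show "card K \<in> {card K |K. K \<subseteq> B \<and> clique K (induced_edges E B)}"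
      using that ind by (auto simp: cliques_def)
  qed
  have "(\<Sum>i = 0..clique_number B (induced_edges E B). of_nat (num_cliques E B i) * x ^ i)
      = (\<Sum>i = 0..clique_number B (induced_edges E B).
          \<Sum>K\<in>{K \<in> cliques E B. card K = i}. x ^ card K)"
  proof (rule sum.cong[OF refl])
    fix i
    have "{K \<in> [B]\<^bsup>i\<^esup>. clique K E} = {K \<in> cliques E B. card K = i}"
      using assms by (auto simp: nsets_def cliques_def intro: finite_subset)
    then show "of_nat (num_cliques E B i) * x ^ i = (\<Sum>K\<in>{K \<in> cliques E B. card K = i}. x ^ card K)"
      by (simp add: num_cliques_def)
  qed
  also have "\<dots> = clique_sum E B x"
    unfolding clique_sum_def
    by (rule sum.group) (use assms bound in \<open>auto simp: finite_cliques\<close>)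
  finally show ?thesis by (simp add: poly_clique_poly)
qed

section \<open>Vertex and edge recursions\<close>

lemma clique_sum_remove_vertex:
  assumes "finite B" "v \<in> B"
  shows "clique_sum E B x
    = clique_sum E (B - {v}) x + x * clique_sum E {w \<in> B - {v}. {v, w} \<in> E} x"
proof -
  let ?N = "{w \<in> B - {v}. {v, w} \<in> E}"
  have split: "cliques E B = cliques E (B - {v}) \<union> insert v ` cliques E ?N"
  proof (intro equalityI subsetI)
    fix K assume K: "K \<in> cliques E B"
    show "K \<in> cliques E (B - {v}) \<union> insert v ` cliques E ?N"
    proof (cases "v \<in> K")
      case True
      have "{v, w} \<in> E" if "w \<in> K - {v}" for w
        using K True that by (auto simp: cliques_def clique_def)
      moreover have "clique (K - {v}) E" "K \<subseteq> B"
        using K by (simp_all add: cliques_def clique_def)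
      ultimately have "K - {v} \<in> cliques E ?N"
        by (auto simp: cliques_def)
      moreover have "K = insert v (K - {v})" using True by auto
      ultimately show ?thesis by blast
    qed (use K in \<open>auto simp: cliques_def\<close>)
  next
    fix K assume "K \<in> cliques E (B - {v}) \<union> insert v ` cliques E ?N"
    then show "K \<in> cliques E B"
    proof
      assume "K \<in> insert v ` cliques E ?N"
      then obtain L where L: "K = insert v L" "L \<subseteq> ?N" "clique L E"
        by (auto simp: cliques_def)
      then have "clique K E" by (auto simp: clique_def insert_commute)
      then show ?thesis using L(1,2) assms(2) by (auto simp: cliques_def)
    qed (auto simp: cliques_def)
  qed
  have notin: "v \<notin> K" "finite K" if "K \<in> cliques E ?N" for K
    using that assms(1) by (auto simp: cliques_def intro: finite_subset)
  have "clique_sum E B x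
      = clique_sum E (B - {v}) x + (\<Sum>K\<in>insert v ` cliques E ?N. x ^ card K)"
    unfolding clique_sum_def split
    by (rule sum.union_disjoint) (use assms in \<open>auto simp: finite_cliques, auto simp: cliques_def\<close>)
  also have "(\<Sum>K\<in>insert v ` cliques E ?N. x ^ card K) = (\<Sum>K\<in>cliques E ?N. x * x ^ card K)"
    by (subst sum.reindex) (use notin in \<open>auto simp: inj_on_def insert_ident\<close>)
  finally show ?thesis by (simp add: clique_sum_def sum_distrib_left)
qed

text \<open>The new cliques are exactly those containing both \<open>u\<close> and \<open>v\<close>;
  as \<open>{u, v}\<close> is not in \<open>E\<close>, none of them was counted before. Deleting the
  pair leaves a clique in the common neighbourhood, and the pair contributes the factor
  \<open>x\<^sup>2\<close>.\<close>

lemma clique_sum_insert_edge: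
  assumes "finite B" "u \<in> B" "v \<in> B" "u \<noteq> v" "{u, v} \<notin> E"
  shows "clique_sum (insert {u, v} E) B x
    = clique_sum E B x + x\<^sup>2 * clique_sum E {w \<in> B - {u, v}. {u, w} \<in> E \<and> {v, w} \<in> E} x"
proof -
  let ?M = "{w \<in> B - {u, v}. {u, w} \<in> E \<and> {v, w} \<in> E}"
  let ?i = "\<lambda>K. insert u (insert v K)"
  have split: "cliques (insert {u, v} E) B = cliques E B \<union> ?i ` cliques E ?M"
  proof (intro equalityI subsetI)
    fix K assume K: "K \<in> cliques (insert {u, v} E) B"
    show "K \<in> cliques E B \<union> ?i ` cliques E ?M"
    proof (cases "u \<in> K \<and> v \<in> K")
      case True
      have "K - {u, v} \<in> cliques E ?M"
        using K True by (auto simp: cliques_def clique_def doubleton_eq_iff)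
      moreover have "K = ?i (K - {u, v})" using True by auto
      ultimately show ?thesis by blast
    qed (use K in \<open>auto simp: cliques_def clique_def doubleton_eq_iff\<close>)
  next
    fix K assume "K \<in> cliques E B \<union> ?i ` cliques E ?M"
    then show "K \<in> cliques (insert {u, v} E) B"
    proof
      assume "K \<in> ?i ` cliques E ?M"
      then obtain L where L: "K = ?i L" "L \<subseteq> ?M" "clique L E"
        by (auto simp: cliques_def)
      then have "clique K (insert {u, v} E)" by (auto simp: clique_def insert_commute)
      then show ?thesis using L(1,2) assms(2,3) by (auto simp: cliques_def)
    qed (auto simp: cliques_def clique_def)
  qed
  have notin: "u \<notin> K" "v \<notin> K" "finite K" if "K \<in> cliques E ?M" for K
    using that assms(1) by (auto simp: cliques_def intro: finite_subset)
  have inj: "inj_on ?i (cliques E ?M)"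
  proof (rule inj_onI)
    fix K L assume KL: "K \<in> cliques E ?M" "L \<in> cliques E ?M" and "?i K = ?i L"
    then have "?i K - {u, v} = ?i L - {u, v}" by simp
    then show "K = L" using notin(1,2)[OF KL(1)] notin(1,2)[OF KL(2)] by auto
  qed
  have "clique_sum (insert {u, v} E) B x
      = clique_sum E B x + (\<Sum>K\<in>?i ` cliques E ?M. x ^ card K)"
    unfolding clique_sum_def split
    by (rule sum.union_disjoint)
       (use assms in \<open>auto simp: finite_cliques, auto simp: cliques_def clique_def\<close>)
  also have "(\<Sum>K\<in>?i ` cliques E ?M. x ^ card K) = (\<Sum>K\<in>cliques E ?M. x\<^sup>2 * x ^ card K)"
    unfolding sum.reindex[OF inj] comp_def
    by (rule sum.cong[OF refl]) (use notin assms(4) in \<open>simp add: power2_eq_square\<close>)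
  finally show ?thesis by (simp add: clique_sum_def sum_distrib_left)
qed

lemma clique_sum_insert_outside:
  assumes "\<not> e \<subseteq> B"
  shows "clique_sum (insert e E) B x = clique_sum E B x"
proof -
  have "cliques (insert e E) B = cliques E B"
    using assms by (auto simp: cliques_def clique_def) (metis insertE singletonD subsetD)
  then show ?thesis by (simp add: clique_sum_def)
qed

section \<open>Positivity on intervals ending at 0\<close>

text \<open>The value at 0 is 1, so a nonpositive value at \<open>y\<close> would force a root in
  \<open>[y, 0]\<close>.\<close>

lemma clique_sum_pos_if_no_root:
  assumes "finite B" and nz: "\<And>y. \<lbrakk>x \<le> y; y \<le> 0\<rbrakk> \<Longrightarrow> clique_sum E B y \<noteq> 0"
    and "x \<le> y" "y \<le> 0"
  shows "clique_sum E B y > 0"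
proof (rule ccontr)
  assume "\<not> ?thesis"
  then have "\<exists>z\<ge>y. z \<le> 0 \<and> clique_sum E B z = 0"
    using assms by (intro IVT') (auto simp: clique_sum_0 continuous_on_clique_sum)
  then show False using nz \<open>x \<le> y\<close> by force
qed

lemma clique_sum_pos_mono:
  assumes "finite B" "U \<subseteq> B"
    and "\<And>y. \<lbrakk>x \<le> y; y \<le> 0\<rbrakk> \<Longrightarrow> clique_sum E B y > 0"
    and "x \<le> y" "y \<le> 0"
  shows "clique_sum E U y > 0"
  using assms
proof (induction "card B" arbitrary: B U x y rule: less_induct)
  case less
  show ?case
  proof (cases "U = B")
    case False
    then obtain v where v: "v \<in> B" "v \<notin> U" using less.prems(2) by blast
    define A where "A = B - {v}"
    define N where "N = {w \<in> B - {v}. {v, w} \<in> E}"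
    have A: "finite A" "card A < card B" "U \<subseteq> A" "N \<subseteq> A"
      using v less.prems(1,2) by (auto simp: A_def N_def intro!: card_Diff1_less simp del: card_Diff_insert card_Diff_singleton)
    have rec: "clique_sum E B z = clique_sum E A z + z * clique_sum E N z" for z
      unfolding A_def N_def using less.prems(1) v(1) by (rule clique_sum_remove_vertex)
    have nz: "clique_sum E A z \<noteq> 0" if "x \<le> z" "z \<le> 0" for z
    proof
      assume "clique_sum E A z = 0"
      \<comment> \<open>Going through \<open>neg_roots\<close> makes \<open>R\<close> finite, so
        that a root nearest to 0 exists. The point 0 itself is never a root.\<close>
      define R where "R = {z \<in> neg_roots E A. x \<le> z}"
      have R_iff: "w \<in> R \<longleftrightarrow> x \<le> w \<and> w \<le> 0 \<and> clique_sum E A w = 0" for w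
        using A(1) by (auto simp: R_def neg_roots_def poly_clique_poly_eq_clique_sum
            clique_sum_0 order.order_iff_strict)
      have R: "finite R" "R \<noteq> {}"
        using \<open>clique_sum E A z = 0\<close> that R_iff[of z]
        by (simp_all add: R_def finite_neg_roots) auto
      define m where "m = Max R"
      have m: "x \<le> m" "m \<le> 0" "clique_sum E A m = 0"
        using Max_in[OF R] by (auto simp: R_iff m_def)
      \<comment> \<open>By maximality of \<open>m\<close>, \<open>A\<close> has no root in
        \<open>[w, 0]\<close>. The induction hypothesis applies to \<open>N \<subseteq> A\<close>
        with \<open>w\<close> as the new left endpoint.\<close>
      have "clique_sum E N w > 0" if "m < w" "w \<le> 0" for w
      proof (rule less.hyps[OF A(2,1,4) _ order.refl that(2)])
        fix y assume y: "w \<le> y" "y \<le> 0"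
        show "clique_sum E A y > 0"
        proof (rule clique_sum_pos_if_no_root[OF A(1) _ y])
          fix y' assume "w \<le> y'" "y' \<le> 0"
          then show "clique_sum E A y' \<noteq> 0"
            using Max_ge[OF R(1), of y'] that m(1) by (force simp: R_iff m_def)
        qed
      qed
      \<comment> \<open>The previous claim stops short of \<open>m\<close>; continuity extends it
        there as a weak inequality, since a negative value at \<open>m\<close> would give
        \<open>N\<close> a root in \<open>(m, 0]\<close>.\<close>
      moreover have "\<exists>w\<ge>m. w \<le> 0 \<and> clique_sum E N w = 0" if "clique_sum E N m < 0"
        using that m(2) finite_subset[OF A(4,1)]
        by (intro IVT') (auto simp: clique_sum_0 continuous_on_clique_sum)
      ultimately have "clique_sum E N m \<ge> 0"
        by (metis less_irrefl not_less order.order_iff_strict)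
      then have "m * clique_sum E N m \<le> 0"
        using m(2) by (simp add: mult_nonpos_nonneg)
      then show False
        \<comment> \<open>At the root \<open>m\<close> of \<open>A\<close>, the recursion leaves
          only \<open>m * clique_sum E N m\<close>, which is nonpositive, against positivity for
          \<open>B\<close>.\<close>
        using rec[of m] m less.prems(3)[of m] by simp
    qed
    have "clique_sum E A z > 0" if "x \<le> z" "z \<le> 0" for z
      using A(1) nz that by (rule clique_sum_pos_if_no_root)
    then show ?thesis
      using less.hyps[OF A(2,1,3)] less.prems by blast
  qed (use less.prems in auto)
qed

lemma clique_sum_pos_add_edges:
  assumes "finite D" "\<And>e. e \<in> D \<Longrightarrow> card e = 2" "finite B"
    and "\<And>y. \<lbrakk>x \<le> y; y \<le> 0\<rbrakk> \<Longrightarrow> clique_sum F B y > 0"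
    and "x \<le> y" "y \<le> 0"
  shows "clique_sum (D \<union> F) B y > 0"
  using assms(1,2,5,6)
\<comment> \<open>Generalising \<open>y\<close> yields positivity on all of \<open>[x, 0]\<close>,
  as needed to pass to the common neighbourhood.\<close>
proof (induction D arbitrary: y rule: finite_induct)
  case empty
  then show ?case using assms(4) by simp
next
  case (insert e D)
  have pos: "clique_sum (D \<union> F) B z > 0" if "x \<le> z" "z \<le> 0" for z
    using insert.IH insert.prems(1) that by simp
  obtain u v where e: "e = {u, v}" "u \<noteq> v"
    using insert.prems(1)[of e] by (auto simp: card_2_iff)
  consider "e \<in> F" | "\<not> e \<subseteq> B" | "u \<in> B" "v \<in> B" "e \<notin> D \<union> F"
    using e insert.hyps(2) by blast
  then show ?case
  proof cases
    case 1
    then have "insert e D \<union> F = D \<union> F" by blast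
    then show ?thesis using pos insert.prems by simp
  next
    case 2
    then show ?thesis
      using pos insert.prems by (simp add: clique_sum_insert_outside)
  next
    case 3
    let ?M = "{w \<in> B - {u, v}. {u, w} \<in> D \<union> F \<and> {v, w} \<in> D \<union> F}"
    have "clique_sum (D \<union> F) ?M y > 0"
      by (rule clique_sum_pos_mono[OF assms(3) _ pos insert.prems(2,3)]) auto
    then have "y\<^sup>2 * clique_sum (D \<union> F) ?M y \<ge> 0" by simp
    moreover have "clique_sum (insert e D \<union> F) B y
        = clique_sum (D \<union> F) B y + y\<^sup>2 * clique_sum (D \<union> F) ?M y"
      using clique_sum_insert_edge[of B u v "D \<union> F" y] 3 e assms(3) by simp
    ultimately show ?thesis using pos insert.prems(2,3) by (smt (verit))
  qed
qed

theorem theorem2p6: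
  fixes V W B :: "'a set" and E F :: "'a set set"
  assumes "finite_simple_graph V E"
    and "spanning_subgraph W F V E"
    and "B \<subseteq> V"
  shows "zeta E B \<le> zeta F B"
proof (rule ccontr)
  assume "\<not> ?thesis"
  then have less: "zeta F B < zeta E B" by simp
  have V: "finite V" and E: "E \<subseteq> [V]\<^bsup>2\<^esup>" and F: "F \<subseteq> E"
    using assms by (auto simp: finite_simple_graph_def spanning_subgraph_def)
  have B: "finite B" using assms(3) V by (rule finite_subset)
  define r where "r = Max (neg_roots E B)"
  \<comment> \<open>A value strictly above another cannot be \<open>-\<infinity>\<close>, so
    \<open>r\<close> is a genuine root.\<close>
  have ne: "neg_roots E B \<noteq> {}" and r_eq: "zeta E B = ereal r"
    using less by (auto simp: zeta_def r_def split: if_splits)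
  have r: "r < 0" "clique_sum E B r = 0"
    using Max_in[OF finite_neg_roots ne] B
    by (auto simp: r_def neg_roots_def poly_clique_poly_eq_clique_sum)
  have nz: "clique_sum F B y \<noteq> 0" if "r \<le> y" "y \<le> 0" for y
  proof
    assume "clique_sum F B y = 0"
    then have y: "y \<in> neg_roots F B"
      using that B by (auto simp: neg_roots_def poly_clique_poly_eq_clique_sum clique_sum_0
          order.order_iff_strict)
    then have "y \<le> Max (neg_roots F B)" by (simp add: finite_neg_roots)
    with y that(1) less show False
      unfolding r_eq by (auto simp: zeta_def split: if_splits)
  qed
  have "finite (E - F)"
    using E V by (meson finite_Diff finite_imp_finite_nsets finite_subset)
  \<comment> \<open>Positivity for \<open>F\<close> on \<open>[r, 0]\<close> survives adding the
    missing edges of \<open>E\<close>, contradicting that \<open>r\<close> is a root for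
    \<open>E\<close>.\<close>
  then have "clique_sum (E - F \<union> F) B r > 0"
  proof (rule clique_sum_pos_add_edges)
    show "card e = 2" if "e \<in> E - F" for e
      using that E by (auto simp: nsets_def)
    show "clique_sum F B y > 0" if "r \<le> y" "y \<le> 0" for y
      using B nz that by (rule clique_sum_pos_if_no_root)
  qed (use B r(1) in auto)
  then show False using F r(2) by (simp add: Un_absorb2)
qed

end
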